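(* Let $n\in\{2,3,4\}$, let $\mathbb{K}$ be a field with $\operatorname{char}(\mathbb{K})=0$ or $\operatorname{char}(\mathbb{K})>n$, and let $V=\mathbb{K}^n$ with the permutation action of $\mathcal{S}_n$. Then for every $m\geq 2$ the set $T_{n,m}$ is a minimal separating set (with respect to inclusion) for the algebra of invariants $\mathbb{K}[V^m]^{\mathcal{S}_n}$, where: (a) for $n=2$: $T_{2,2}=\{\operatorname{tr}(r,0),\operatorname{tr}(0,r),\operatorname{tr}(1,1)\mid r=1,2\}$ and $T_{2,m}=(T_{2,2})^{[m]}$ for all $m\geq 3$; (b) for $n=3$: $T_{3,2}=\{\operatorname{tr}(r,0),\operatorname{tr}(0,r),\operatorname{tr}(1,1),\operatorname{tr}(2,1)\mid r=1,2,3\}$ and $T_{3,m}=(T_{3,2})^{[m]}$ for all $m\geq 3$; (c) for $n=4$: $T_{4,2}=\{\operatorname{tr}(r,0),\operatorname{tr}(0,r),\operatorname{tr}(1,1),\operatorname{tr}(2,1),\operatorname{tr}(1,2),\operatorname{tr}(3,1)\mid r=1,2,3,4\}$, $T_{4,3}=(T_{4,2})^{[3]}\cup\{\operatorname{tr}(1,1,1)\}$, and $T_{4,m}=(T_{4,3})^{[m]}$ for all $m\geq 4$.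
   Context: $\mathcal{S}_n$ is the symmetric group on $\{1,\ldots,n\}$. It acts on $V=\mathbb{K}^n$ by permuting coordinates and diagonally on $V^m = V\oplus\cdots\oplus V$ ($m$ copies). The coordinate ring of $V^m$ is the polynomial ring $\mathbb{K}[V^m]=\mathbb{K}[x(j)_i \mid i=1,\ldots,n,\ j=1,\ldots,m]$, where $x(j)_i$ sends $(a_1,\ldots,a_m)\in V^m$ to the $i$-th coordinate $(a_j)_i$ of $a_j$; $\mathbb{K}[V^m]^{\mathcal{S}_n}$ is its subring of $\mathcal{S}_n$-invariants. Power sums: for $\underline{k}=(k_1,\ldots,k_m)\in\mathbb{N}^m$ (with $0\in\mathbb{N}$), $\operatorname{tr}(\underline{k})=\sum_{i=1}^n x(1)_i^{k_1}\cdots x(m)_i^{k_m}\in\mathbb{K}[V^m]^{\mathcal{S}_n}$. Separating set: given a subset $S$ of $\mathbb{K}[V^m]^{\mathcal{S}_n}$, elements $u,v\in V^m$ can be separated by $S$ if there is $f\in S$ with $f(u)\neq f(v)$. The set $S$ is separating if any $u,v\in V^m$ that can be separated by $\mathbb{K}[V^m]^{\mathcal{S}_n}$ can also be separated by $S$. A separating set is minimal if it is minimal with respect to inclusion among all separating sets of $\mathbb{K}[V^m]^{\mathcal{S}_n}$. Expansion: let $1\le m_0\leq m$. A tuple $\underline{j}=(j_1,\ldots,j_{m_0})\in\mathbb{N}^{m_0}$ is $m$-admissible if $1\leq j_1<\cdots<j_{m_0}\leq m$. For $m$-admissible $\underline{j}$ and $f\in\mathbb{K}[V^{m_0}]^{\mathcal{S}_n}$,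 let $f^{(\underline{j})}\in\mathbb{K}[V^m]^{\mathcal{S}_n}$ be the result of substituting $x(l)_i\to x(j_l)_i$ in $f$ for all $1\leq l\leq m_0$, $1\leq i\leq n$. For $S\subset\mathbb{K}[V^{m_0}]^{\mathcal{S}_n}$ the expansion is $S^{[m]}=\{f^{(\underline{j})}\mid f\in S \text{ and } \underline{j}\in\mathbb{N}^{m_0}\text{ is } m\text{-admissible}\}\subset\mathbb{K}[V^m]^{\mathcal{S}_n}$. *)

theory Defs
  imports
    "HOL-Library.Poly_Mapping"
    "HOL-Library.FuncSet"
    "HOL-Combinatorics.Permutations"
begin

section \<open>Coordinate rings of vector tuples\<close>

text \<open>
  Multivariate polynomials are finitely supported functions from monomials to coefficients, and
  monomials are finitely supported functions from variables to exponents. The pair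
  \<open>(j, i)\<close> is the name of the variable \<open>x(j)\<^sub>i\<close>: \<open>j\<close> is the number of the
  vector and \<open>i\<close> the number of its coordinate. All indices start at 1.
\<close>

type_synonym 'a vpoly = "((nat \<times> nat) \<Rightarrow>\<^sub>0 nat) \<Rightarrow>\<^sub>0 'a"

definition X :: "nat \<Rightarrow> nat \<Rightarrow> 'a::comm_ring_1 vpoly"
  where "X j i = Poly_Mapping.single (Poly_Mapping.single (j, i) 1) 1"

definition coord_ring :: "nat \<Rightarrow> nat \<Rightarrow> 'a::comm_ring_1 vpoly set"
  where "coord_ring n m = {p. \<forall>t\<in>Poly_Mapping.keys p. Poly_Mapping.keys t \<subseteq> {1..m} \<times> {1..n}}"

definition vec_tuples :: "nat \<Rightarrow> nat \<Rightarrow> (nat \<Rightarrow> nat \<Rightarrow> 'a) set"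
  where "vec_tuples n m = {1..m} \<rightarrow>\<^sub>E ({1..n} \<rightarrow>\<^sub>E UNIV)"

text \<open>
  The evaluation homomorphism that applies \<open>c\<close> to the coefficients and sends the variable
  \<open>x(j)\<^sub>i\<close> to \<open>g (j, i)\<close>.
\<close>

definition insertion :: "('a \<Rightarrow> 'b) \<Rightarrow> (nat \<times> nat \<Rightarrow> 'b) \<Rightarrow> 'a::comm_ring_1 vpoly \<Rightarrow> 'b::comm_ring_1"
  where "insertion c g p =
    (\<Sum>t\<in>Poly_Mapping.keys p. c (Poly_Mapping.lookup p t) *
      (\<Prod>v\<in>Poly_Mapping.keys t. g v ^ Poly_Mapping.lookup t v))"

definition eval_at :: "(nat \<Rightarrow> nat \<Rightarrow> 'a) \<Rightarrow> 'a::comm_ring_1 vpoly \<Rightarrow> 'a"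
  where "eval_at a = insertion (\<lambda>c. c) (\<lambda>(j, i). a j i)"

definition subst_vars :: "(nat \<times> nat \<Rightarrow> 'a vpoly) \<Rightarrow> 'a::comm_ring_1 vpoly \<Rightarrow> 'a vpoly"
  where "subst_vars = insertion (Poly_Mapping.single 0)"


section \<open>Invariants of the symmetric group\<close>

text \<open>
  The action on polynomials induced by permuting coordinates, \<open>x(j)\<^sub>i\<close> being sent to
  \<open>x(j)\<^bsub>\<sigma>(i)\<^esub>\<close>. It acts on polynomials rather than on polynomial functions, which makes a
  difference over finite fields.
\<close>

definition perm_act :: "(nat \<Rightarrow> nat) \<Rightarrow> 'a::comm_ring_1 vpoly \<Rightarrow> 'a vpoly"
  where "perm_act \<sigma> = subst_vars (\<lambda>(j, i). X j (\<sigma> i))"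

definition invariants :: "nat \<Rightarrow> nat \<Rightarrow> 'a::comm_ring_1 vpoly set"
  where "invariants n m =
    {f \<in> coord_ring n m. \<forall>\<sigma>. \<sigma> permutes {1..n} \<longrightarrow> perm_act \<sigma> f = f}"

text \<open>The list \<open>[k\<^sub>1, \<dots>, k\<^sub>m]\<close> encodes a tuple of exponents; list positions start at 0.\<close>

definition tr :: "nat \<Rightarrow> nat list \<Rightarrow> 'a::comm_ring_1 vpoly"
  where "tr n k = (\<Sum>i=1..n. \<Prod>j=1..length k. X j i ^ (k ! (j - 1)))"


section \<open>Separating sets\<close>

definition separated_by :: "'a::comm_ring_1 vpoly set \<Rightarrow> (nat \<Rightarrow> nat \<Rightarrow> 'a) \<Rightarrow> (nat \<Rightarrow> nat \<Rightarrow> 'a) \<Rightarrow> bool"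
  where "separated_by S u v \<longleftrightarrow> (\<exists>f\<in>S. eval_at u f \<noteq> eval_at v f)"

definition separating :: "nat \<Rightarrow> nat \<Rightarrow> 'a::comm_ring_1 vpoly set \<Rightarrow> bool"
  where "separating n m S \<longleftrightarrow>
    S \<subseteq> invariants n m \<and>
    (\<forall>u\<in>vec_tuples n m. \<forall>v\<in>vec_tuples n m.
      separated_by (invariants n m) u v \<longrightarrow> separated_by S u v)"

definition minimal_separating :: "nat \<Rightarrow> nat \<Rightarrow> 'a::comm_ring_1 vpoly set \<Rightarrow> bool"
  where "minimal_separating n m S \<longleftrightarrow>
    separating n m S \<and> (\<forall>S'. S' \<subseteq> S \<and> separating n m S' \<longrightarrow> S' = S)"


section \<open>Expansions\<close>

definition admissible :: "nat \<Rightarrow> nat \<Rightarrow> nat list \<Rightarrow> bool"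
  where "admissible m0 m js \<longleftrightarrow>
    length js = m0 \<and> sorted_wrt (<) js \<and> set js \<subseteq> {1..m}"

definition relabel :: "nat list \<Rightarrow> 'a::comm_ring_1 vpoly \<Rightarrow> 'a vpoly"
  where "relabel js = subst_vars (\<lambda>(l, i). X (js ! (l - 1)) i)"

text \<open>To be applied to subsets \<open>S\<close> of \<^term>\<open>coord_ring n m0\<close> with \<open>1 \<le> m0 \<le> m\<close>.\<close>

definition expansion :: "nat \<Rightarrow> nat \<Rightarrow> 'a::comm_ring_1 vpoly set \<Rightarrow> 'a vpoly set"
  where "expansion m0 m S = {relabel js f | f js. f \<in> S \<and> admissible m0 m js}"


section \<open>The sets of power sums\<close>

definition T22 :: "'a::comm_ring_1 vpoly set"
  where "T22 = (\<Union>r\<in>{1..2}. {tr 2 [r, 0], tr 2 [0, r]}) \<union> {tr 2 [1, 1]}"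

definition T32 :: "'a::comm_ring_1 vpoly set"
  where "T32 = (\<Union>r\<in>{1..3}. {tr 3 [r, 0], tr 3 [0, r]}) \<union> {tr 3 [1, 1], tr 3 [2, 1]}"

definition T42 :: "'a::comm_ring_1 vpoly set"
  where "T42 = (\<Union>r\<in>{1..4}. {tr 4 [r, 0], tr 4 [0, r]}) \<union>
    {tr 4 [1, 1], tr 4 [2, 1], tr 4 [1, 2], tr 4 [3, 1]}"

definition T43 :: "'a::comm_ring_1 vpoly set"
  where "T43 = expansion 2 3 T42 \<union> {tr 4 [1, 1, 1]}"

text \<open>Only meaningful for \<open>n \<in> {2, 3, 4}\<close> and \<open>m \<ge> 2\<close>; empty otherwise.\<close>

definition T_set :: "nat \<Rightarrow> nat \<Rightarrow> 'a::comm_ring_1 vpoly set"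
  where "T_set n m =
    (if n = 2 \<and> m = 2 then T22
     else if n = 2 \<and> m \<ge> 3 then expansion 2 m T22
     else if n = 3 \<and> m = 2 then T32
     else if n = 3 \<and> m \<ge> 3 then expansion 2 m T32
     else if n = 4 \<and> m = 2 then T42
     else if n = 4 \<and> m = 3 then T43
     else if n = 4 \<and> m \<ge> 4 then expansion 3 m T43
     else {})"

end

theory Submission
  imports Defs "HOL-Computational_Algebra.Polynomial_FPS"
begin

text \<open>
  Separation. Let two tuples \<open>u\<close>, \<open>v\<close> take equal values on all listed power sums. The claim is
  that they lie in one orbit, so that all invariants agree on them
  (\<open>same_orbit_if_power_sums_eq\<close>). The rows \<open>u 1\<close>, \<open>u 2\<close>, ... are aligned with those of \<open>v\<close> one
  at a time by permutations of the columns. Suppose that the rows in \<open>J\<close> already agree and that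
  \<open>c\<close>, \<open>c'\<close> are the next rows of \<open>u\<close> and \<open>v\<close>. An aligned row \<open>a\<close> partitions the columns by its
  values. As \<open>a\<close> has at most \<open>n\<close> values, Lagrange interpolation turns the equality of the sums of
  \<open>a\<^sup>k c\<close> for \<open>k < n\<close> into the equality of the sums of \<open>c\<close> and \<open>c'\<close> over each class of this
  partition (\<open>class_sums_eq_0\<close>). With the power sums of \<open>c\<close> alone, Newton's identities
  (\<open>multiset_eq_if_power_sums_eq\<close>) then yield that \<open>c\<close> and \<open>c'\<close> take the same values with the
  same multiplicities on every class of \<open>a\<close> (\<open>class_mset_eq\<close>). For \<open>n = 4\<close> and two classes of size
  two this needs \<open>tr(1,2)\<close> as well.

  It remains to pass from the partitions given by single rows to their common refinement. A function
  on at most four points whose sums vanish over the classes of two partitions also has vanishing sums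
  over the classes of the common refinement, unless the partitions cross, that is, they are of the
  form \<open>12|34\<close> and \<open>13|24\<close> (\<open>joint_class_sums_eq_0\<close>). Without a crossing, \<open>c\<close> and \<open>c'\<close> differ by a
  permutation of the columns that fixes the aligned rows. At a crossing, \<open>c - c'\<close> is a multiple of
  the sign pattern \<open>(1, -1, -1, 1)\<close>, and \<open>tr(1,1,1)\<close> shows that this multiple is 0
  (\<open>align_next_row\<close>).

  Minimality. For every listed power sum there are two integer matrices, with one row for each
  variable block that occurs in it, on which it takes different values while all other listed power
  sums agree (\<open>isolates_2\<close>, \<open>isolates_3\<close>, \<open>isolates_4\<close>). The difference of the two values divides
  a power of \<open>n!\<close> and hence does not vanish in the field, and filling up with zero rows gives tuples
  of any length (\<open>separated_only_by\<close>). So no element can be left out of the set.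
\<close>

section \<open>Evaluation and substitution\<close>

definition monomial_value :: "('v \<Rightarrow> 'b::comm_ring_1) \<Rightarrow> ('v \<Rightarrow>\<^sub>0 nat) \<Rightarrow> 'b"
  where "monomial_value g t = (\<Prod>v\<in>Poly_Mapping.keys t. g v ^ Poly_Mapping.lookup t v)"

lemma monomial_value_superset:
  assumes "finite V" "Poly_Mapping.keys t \<subseteq> V"
  shows "monomial_value g t = (\<Prod>v\<in>V. g v ^ Poly_Mapping.lookup t v)"
  unfolding monomial_value_def using assms by (intro prod.mono_neutral_left) (auto simp: in_keys_iff)

lemma monomial_value_add: "monomial_value g (s + t) = monomial_value g s * monomial_value g t"
proof -
  define V where "V = Poly_Mapping.keys s \<union> Poly_Mapping.keys t"
  have V: "finite V" "Poly_Mapping.keys s \<subseteq> V" "Poly_Mapping.keys t \<subseteq> V"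
    "Poly_Mapping.keys (s + t) \<subseteq> V"
    using Poly_Mapping.keys_add[of s t] by (auto simp: V_def)
  show ?thesis
    by (simp add: monomial_value_superset[OF V(1,2)] monomial_value_superset[OF V(1,3)]
        monomial_value_superset[OF V(1,4)] lookup_add power_add prod.distrib)
qed

lemma update_eq_add:
  "k \<notin> Poly_Mapping.keys p \<Longrightarrow> Poly_Mapping.update k b p = p + Poly_Mapping.single k b"
  by (rule poly_mapping_eqI) (auto simp: lookup_add lookup_update lookup_single in_keys_iff when_def)

text \<open>
  Substitutions have the coefficient map \<open>Poly_Mapping.single 0\<close>, evaluations have the identity;
  the locale treats both at once.
\<close>

locale coeff_hom =
  fixes c :: "'a::comm_ring_1 \<Rightarrow> 'b::comm_ring_1" and g :: "nat \<times> nat \<Rightarrow> 'b"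
  assumes c_0: "c 0 = 0" and c_1: "c 1 = 1"
    and c_add: "c (a + b) = c a + c b" and c_mult: "c (a * b) = c a * c b"
begin

lemma insertion_superset:
  assumes "finite T" "Poly_Mapping.keys p \<subseteq> T"
  shows "insertion c g p = (\<Sum>t\<in>T. c (Poly_Mapping.lookup p t) * monomial_value g t)"
  unfolding insertion_def monomial_value_def[symmetric] using assms
  by (intro sum.mono_neutral_left) (auto simp: in_keys_iff c_0)

lemma insertion_add: "insertion c g (p + q) = insertion c g p + insertion c g q"
proof -
  define T where "T = Poly_Mapping.keys p \<union> Poly_Mapping.keys q"
  have T: "finite T" "Poly_Mapping.keys p \<subseteq> T" "Poly_Mapping.keys q \<subseteq> T"
    "Poly_Mapping.keys (p + q) \<subseteq> T"
    using Poly_Mapping.keys_add[of p q] by (auto simp: T_def)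
  show ?thesis
    by (simp add: insertion_superset[OF T(1,2)] insertion_superset[OF T(1,3)]
        insertion_superset[OF T(1,4)] lookup_add c_add algebra_simps sum.distrib)
qed

lemma insertion_0: "insertion c g 0 = 0"
  by (simp add: insertion_def)

lemma insertion_sum: "insertion c g (\<Sum>i\<in>I. f i) = (\<Sum>i\<in>I. insertion c g (f i))"
  by (induction I rule: infinite_finite_induct) (simp_all add: insertion_0 insertion_add)

lemma insertion_single: "insertion c g (Poly_Mapping.single t a) = c a * monomial_value g t"
  by (simp add: insertion_superset[of "{t}"] lookup_single)

lemma insertion_mult: "insertion c g (p * q) = insertion c g p * insertion c g q"
proof -
  have single: "insertion c g (Poly_Mapping.single t a * q) = c a * monomial_value g t * insertion c g q"
    for t a q
  proof (induction q rule: update_induct)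
    case const
    then show ?case by (simp add: insertion_0)
  next
    case (update q s b)
    then show ?case
      by (simp add: update_eq_add distrib_left insertion_add insertion_single mult_single
          monomial_value_add c_mult algebra_simps)
  qed
  show ?thesis
  proof (induction p rule: update_induct)
    case const
    then show ?case by (simp add: insertion_0)
  next
    case (update p s b)
    then show ?case
      by (simp add: update_eq_add distrib_right insertion_add insertion_single single)
  qed
qed

lemma insertion_1: "insertion c g 1 = 1"
  using insertion_single[of 0 1] by (simp add: c_1 monomial_value_def)

lemma insertion_power: "insertion c g (p ^ k) = insertion c g p ^ k"
  by (induction k) (simp_all add: insertion_1 insertion_mult)

lemma insertion_prod: "insertion c g (\<Prod>i\<in>I. f i) = (\<Prod>i\<in>I. insertion c g (f i))"
  by (induction I rule: infinite_finite_induct) (simp_all add: insertion_1 insertion_mult)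

lemma insertion_X: "insertion c g (X j i) = g (j, i)"
  by (simp add: X_def insertion_single monomial_value_def c_1)

lemmas insertion_simps = insertion_add insertion_0 insertion_sum insertion_mult insertion_1
  insertion_power insertion_prod insertion_X insertion_single

end

interpretation eval: coeff_hom "\<lambda>c. c" "\<lambda>(j, i). u j i" for u
  by unfold_locales auto

interpretation subst: coeff_hom "Poly_Mapping.single 0" h for h
  by unfold_locales (auto simp: single_add mult_single)

lemma eval_at_subst_vars:
  "eval_at u (subst_vars h p) = eval_at (\<lambda>j i. eval_at u (h (j, i))) p"
proof -
  have "eval_at u (monomial_value h t) = (\<Prod>v\<in>Poly_Mapping.keys t. eval_at u (h v) ^ Poly_Mapping.lookup t v)"
    for t
    by (simp add: monomial_value_def eval_at_def eval.insertion_simps)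
  moreover have "eval_at u (subst_vars h p) =
    (\<Sum>t\<in>Poly_Mapping.keys p. Poly_Mapping.lookup p t * eval_at u (monomial_value h t))"
    by (simp add: subst_vars_def insertion_def[of "Poly_Mapping.single 0"] eval_at_def
        eval.insertion_simps monomial_value_def)
  ultimately show ?thesis
    by (simp add: eval_at_def[of "\<lambda>j i. eval_at u (h (j, i))"] insertion_def case_prod_beta)
qed

lemma eval_at_perm_act: "eval_at u (perm_act \<sigma> f) = eval_at (\<lambda>j i. u j (\<sigma> i)) f"
  by (simp add: perm_act_def eval_at_subst_vars) (simp add: eval_at_def eval.insertion_X)

lemma eval_at_cong:
  assumes "f \<in> coord_ring n m" and "\<And>j i. j \<in> {1..m} \<Longrightarrow> i \<in> {1..n} \<Longrightarrow> u j i = v j i"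
  shows "eval_at u f = eval_at v f"
  unfolding eval_at_def insertion_def
proof (intro sum.cong refl arg_cong2[of _ _ _ _ "(*)"] prod.cong)
  fix t w assume "t \<in> Poly_Mapping.keys f" "w \<in> Poly_Mapping.keys t"
  then have "w \<in> {1..m} \<times> {1..n}" using assms(1) by (auto simp: coord_ring_def)
  then show "(case w of (j, i) \<Rightarrow> u j i) ^ Poly_Mapping.lookup t w =
      (case w of (j, i) \<Rightarrow> v j i) ^ Poly_Mapping.lookup t w"
    using assms(2) by auto
qed

text \<open>
  Permuting the variables of \<open>f\<close> amounts to permuting the columns of the point, and an invariant
  equals its permuted form.
\<close>

lemma eval_at_eq_if_same_orbit:
  assumes "f \<in> invariants n m" and "\<sigma> permutes {1..n}"
    and "\<And>j i. j \<in> {1..m} \<Longrightarrow> i \<in> {1..n} \<Longrightarrow> v j i = u j (\<sigma> i)"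
  shows "eval_at u f = eval_at v f"
proof -
  have "eval_at u f = eval_at (\<lambda>j i. u j (\<sigma> i)) f"
    using assms(1,2) eval_at_perm_act[of u \<sigma> f] by (simp add: invariants_def)
  also have "\<dots> = eval_at v f"
    using assms by (intro eval_at_cong[where n = n and m = m]) (auto simp: invariants_def)
  finally show ?thesis .
qed

text \<open>
  \<open>tr\<close> with the \<open>l\<close>-th exponent attached to row \<open>js ! l\<close>. Unlike \<open>tr\<close>, this family is closed under
  relabelling, and exponents equal to 0 can be dropped.
\<close>

definition psum :: "nat \<Rightarrow> nat list \<Rightarrow> nat list \<Rightarrow> 'a::comm_ring_1 vpoly"
  where "psum n js k = (\<Sum>i=1..n. \<Prod>l<length k. X (js ! l) i ^ (k ! l))"

lemma tr_eq_psum: "tr n k = psum n [1..<Suc (length k)] k"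
  unfolding tr_def psum_def
  by (intro sum.cong refl prod.reindex_bij_witness[where i = Suc and j = "\<lambda>j. j - 1"])
    (auto simp del: upt_Suc)

lemma eval_at_psum: "eval_at u (psum n js k) = (\<Sum>i=1..n. \<Prod>l<length k. u (js ! l) i ^ (k ! l))"
  by (simp add: psum_def eval_at_def eval.insertion_simps)

lemma perm_act_psum:
  assumes "\<sigma> permutes {1..n}"
  shows "perm_act \<sigma> (psum n js k) = psum n js k"
proof -
  have "perm_act \<sigma> (psum n js k) = (\<Sum>i=1..n. \<Prod>l<length k. X (js ! l) (\<sigma> i) ^ (k ! l))"
    by (simp add: psum_def perm_act_def subst_vars_def subst.insertion_simps)
  also have "\<dots> = psum n js k"
    unfolding psum_def using assms by (rule sum.permute[symmetric, unfolded o_def])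
  finally show ?thesis .
qed

lemma relabel_psum:
  assumes "length js = length k"
  shows "relabel js' (psum n js k) = psum n (map (\<lambda>l. js' ! (l - 1)) js) k"
  using assms by (simp add: psum_def relabel_def subst_vars_def subst.insertion_simps)

lemma coord_ring_add: "p \<in> coord_ring n m \<Longrightarrow> q \<in> coord_ring n m \<Longrightarrow> p + q \<in> coord_ring n m"
  using Poly_Mapping.keys_add[of p q] by (auto simp: coord_ring_def)

lemma coord_ring_mult:
  assumes "p \<in> coord_ring n m" "q \<in> coord_ring n m"
  shows "p * q \<in> coord_ring n m"
proof -
  have "Poly_Mapping.keys t \<subseteq> {1..m} \<times> {1..n}" if t: "t \<in> Poly_Mapping.keys (p * q)" for t
  proof -
    obtain a b where "t = a + b" "a \<in> Poly_Mapping.keys p" "b \<in> Poly_Mapping.keys q"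
      using keys_mult[of p q] t by blast
    then show ?thesis
      using assms Poly_Mapping.keys_add[of a b] by (fastforce simp: coord_ring_def)
  qed
  then show ?thesis by (simp add: coord_ring_def)
qed

lemma psum_in_coord_ring:
  assumes "length js = length k" "set js \<subseteq> {1..m}"
  shows "psum n js k \<in> coord_ring n m"
proof -
  have X: "X j i \<in> coord_ring n m" if "j \<in> {1..m}" "i \<in> {1..n}" for j i
    using that by (simp add: X_def coord_ring_def)
  have zero: "0 \<in> coord_ring n m" and one: "1 \<in> coord_ring n m" by (simp_all add: coord_ring_def)
  have power: "p ^ e \<in> coord_ring n m" if "p \<in> coord_ring n m" for p :: "'a vpoly" and e
    using that by (induction e) (auto intro: coord_ring_mult one)
  have prod: "(\<Prod>l\<in>L. f l) \<in> coord_ring n m" if "\<And>l. l \<in> L \<Longrightarrow> f l \<in> coord_ring n m"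
    for L and f :: "nat \<Rightarrow> 'a vpoly"
    using that by (induction L rule: infinite_finite_induct) (auto intro: coord_ring_mult one)
  have sum: "(\<Sum>l\<in>L. f l) \<in> coord_ring n m" if "\<And>l. l \<in> L \<Longrightarrow> f l \<in> coord_ring n m"
    for L and f :: "nat \<Rightarrow> 'a vpoly"
    using that by (induction L rule: infinite_finite_induct) (auto intro: coord_ring_add zero)
  have "js ! l \<in> {1..m}" if "l < length k" for l
    using assms nth_mem[of l js] that by (metis subsetD)
  then show ?thesis unfolding psum_def by (intro sum prod power X) auto
qed

lemma psum_in_invariants:
  assumes "length js = length k" "set js \<subseteq> {1..m}"
  shows "psum n js k \<in> invariants n m"
  using psum_in_coord_ring[OF assms] perm_act_psum by (auto simp: invariants_def)


section \<open>Expansions of families of power sums\<close>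

definition power_sums :: "nat \<Rightarrow> nat list set \<Rightarrow> nat \<Rightarrow> 'a::comm_ring_1 vpoly set"
  where "power_sums n K m = {psum n js k | js k. k \<in> K \<and> admissible (length k) m js}"

lemma admissible_distinct: "admissible p m js \<Longrightarrow> distinct js"
  by (simp add: admissible_def strict_sorted_iff)

lemma admissible_le:
  assumes "admissible p m js"
  shows "p \<le> m"
proof -
  have "p = card (set js)"
    using assms admissible_distinct[OF assms] by (simp add: admissible_def distinct_card)
  also have "\<dots> \<le> card {1..m}" using assms by (intro card_mono) (auto simp: admissible_def)
  finally show ?thesis by simp
qed

lemma admissible_compose:
  assumes outer: "admissible m0 m js'" and inner: "admissible p m0 js0"
  shows "admissible p m (map (\<lambda>l. js' ! (l - 1)) js0)"
proof -
  have range: "l - 1 < length js' \<and> 1 \<le> l" if "l \<in> set js0" for l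
    using that inner outer by (fastforce simp: admissible_def)
  have "sorted_wrt (\<lambda>a b. js' ! (a - 1) < js' ! (b - 1)) js0"
    using inner by (auto simp: admissible_def intro!: sorted_wrt_mono_rel[of js0 "(<)"]
        sorted_wrt_nth_less[of "(<)" js'] outer[unfolded admissible_def, THEN conjunct2, THEN conjunct1]
        dest!: range)
  moreover have "js' ! (l - 1) \<in> {1..m}" if "l \<in> set js0" for l
    using range[OF that] outer nth_mem[of "l - 1" js'] unfolding admissible_def by blast
  ultimately show ?thesis using inner by (auto simp: admissible_def sorted_wrt_map)
qed

text \<open>
  The entries of \<open>js0\<close> are the positions at which the entries of \<open>js\<close> occur in \<open>js'\<close>.
\<close>

lemma admissible_within:
  assumes outer: "admissible m0 m js'" and js: "admissible p m js" and sub: "set js \<subseteq> set js'"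
  obtains js0 where "admissible p m0 js0" "js = map (\<lambda>l. js' ! (l - 1)) js0"
proof -
  have "length js' = m0" using outer by (simp add: admissible_def)
  then have "\<exists>i<m0. js' ! i = x" if "x \<in> set js" for x
    using sub that in_set_conv_nth[of x js'] by blast
  then obtain pos where pos: "\<And>x. x \<in> set js \<Longrightarrow> pos x < m0 \<and> js' ! pos x = x"
    by metis
  have mono: "pos x < pos y" if "x \<in> set js" "y \<in> set js" "x < y" for x y
  proof (rule ccontr)
    assume "\<not> ?thesis"
    then have "pos y < pos x \<or> pos y = pos x" by auto
    then have "js' ! pos y \<le> js' ! pos x"
      using outer pos[OF that(1)] sorted_wrt_nth_less[of "(<)" js' "pos y" "pos x"]
      by (auto simp: admissible_def)
    then show False using pos that by simp
  qed
  define js0 where "js0 = map (\<lambda>x. Suc (pos x)) js"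
  have "sorted_wrt (\<lambda>x y. pos x < pos y) js"
    using js mono by (auto simp: admissible_def intro: sorted_wrt_mono_rel[of js "(<)"])
  then have "admissible p m0 js0"
    using js pos by (fastforce simp: admissible_def js0_def sorted_wrt_map)
  moreover have "js = map (\<lambda>l. js' ! (l - 1)) js0"
    using pos by (simp add: js0_def map_idI o_def)
  ultimately show ?thesis using that by blast
qed

text \<open>
  Any \<open>p\<close> rows can be completed to \<open>m0\<close> rows. This makes an expansion in two steps the same as an
  expansion in one step.
\<close>

lemma admissible_factor:
  assumes js: "admissible p m js" and "p \<le> m0" "m0 \<le> m"
  obtains js' js0 where "admissible m0 m js'" "admissible p m0 js0"
    "js = map (\<lambda>l. js' ! (l - 1)) js0"
proof -
  have "card (set js) = p"
    using js admissible_distinct[OF js] by (simp add: admissible_def distinct_card)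
  then obtain B where B: "set js \<subseteq> B" "B \<subseteq> {1..m}" "card B = m0"
    using exists_subset_between[of "set js" m0 "{1..m}"] js assms by (auto simp: admissible_def)
  then have "finite B" by (meson finite_atLeastAtMost finite_subset)
  then have outer: "admissible m0 m (sorted_list_of_set B)"
    using B by (simp add: admissible_def)
  show ?thesis
    by (rule admissible_within[OF outer js]) (use B \<open>finite B\<close> that outer in auto)
qed

lemma expansion_power_sums:
  assumes K: "\<And>k. k \<in> K \<Longrightarrow> length k \<le> m0" and "m0 \<le> m"
  shows "expansion m0 m (power_sums n K m0) = power_sums n K m"
proof (intro equalityI subsetI)
  fix f assume "f \<in> expansion m0 m (power_sums n K m0)"
  then obtain js' js k where f: "f = relabel js' (psum n js k)" and "k \<in> K"
    and adm: "admissible m0 m js'" "admissible (length k) m0 js"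
    unfolding expansion_def power_sums_def by blast
  have "f = psum n (map (\<lambda>l. js' ! (l - 1)) js) k"
    using adm by (simp add: f relabel_psum admissible_def)
  then show "f \<in> power_sums n K m"
    using admissible_compose[OF adm] \<open>k \<in> K\<close> unfolding power_sums_def by blast
next
  fix f assume "f \<in> power_sums n K m"
  then obtain js k where f: "f = psum n js k" "k \<in> K" "admissible (length k) m js"
    unfolding power_sums_def by blast
  then obtain js' js0 where adm: "admissible m0 m js'" "admissible (length k) m0 js0"
    and "js = map (\<lambda>l. js' ! (l - 1)) js0"
    using admissible_factor K \<open>m0 \<le> m\<close> by metis
  then have "f = relabel js' (psum n js0 k)"
    using f by (simp add: relabel_psum admissible_def)
  then show "f \<in> expansion m0 m (power_sums n K m0)"
    using adm f unfolding expansion_def power_sums_def by blast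
qed

text \<open>
  The exponent patterns, without zeros, of the power sums in the sets to be shown minimal.
\<close>

definition exps :: "nat \<Rightarrow> nat list set"
  where "exps n =
    (if n = 2 then {[1], [2], [1, 1]}
     else if n = 3 then {[1], [2], [3], [1, 1], [2, 1]}
     else {[1], [2], [3], [4], [1, 1], [2, 1], [1, 2], [3, 1], [1, 1, 1]})"

lemma admissible_1: "admissible (Suc 0) m js \<longleftrightarrow> (\<exists>j\<in>{1..m}. js = [j])"
  by (auto simp: admissible_def length_Suc_conv)

lemma admissible_2:
  "admissible (Suc (Suc 0)) m js \<longleftrightarrow> (\<exists>j k. 1 \<le> j \<and> j < k \<and> k \<le> m \<and> js = [j, k])"
  by (auto simp: admissible_def length_Suc_conv)

lemma admissible_3:
  "admissible (Suc (Suc (Suc 0))) m js \<longleftrightarrow>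
    (\<exists>j k l. 1 \<le> j \<and> j < k \<and> k < l \<and> l \<le> m \<and> js = [j, k, l])"
  by (auto simp: admissible_def length_Suc_conv)

lemma admissible_small:
  "admissible (Suc 0) (Suc 0) js \<longleftrightarrow> js = [1]"
  "admissible (Suc 0) (Suc (Suc 0)) js \<longleftrightarrow> js = [1] \<or> js = [2]"
  "admissible (Suc 0) (Suc (Suc (Suc 0))) js \<longleftrightarrow> js = [1] \<or> js = [2] \<or> js = [3]"
  "admissible (Suc (Suc 0)) (Suc 0) js \<longleftrightarrow> False"
  "admissible (Suc (Suc 0)) (Suc (Suc 0)) js \<longleftrightarrow> js = [1, 2]"
  "admissible (Suc (Suc 0)) (Suc (Suc (Suc 0))) js \<longleftrightarrow> js = [1, 2] \<or> js = [1, 3] \<or> js = [2, 3]"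
  "admissible (Suc (Suc (Suc 0))) (Suc 0) js \<longleftrightarrow> False"
  "admissible (Suc (Suc (Suc 0))) (Suc (Suc 0)) js \<longleftrightarrow> False"
  "admissible (Suc (Suc (Suc 0))) (Suc (Suc (Suc 0))) js \<longleftrightarrow> js = [1, 2, 3]"
proof -
  have small: "(1 \<le> j \<and> j < k \<and> k \<le> Suc (Suc (Suc 0))) \<longleftrightarrow>
    (j = 1 \<and> k = 2 \<or> j = 1 \<and> k = 3 \<or> j = 2 \<and> k = 3)" for j k :: nat
    by auto
  show "admissible (Suc (Suc 0)) (Suc (Suc (Suc 0))) js \<longleftrightarrow>
    js = [1, 2] \<or> js = [1, 3] \<or> js = [2, 3]"
    unfolding admissible_2 using small by metis
qed (auto simp: admissible_1 admissible_2 admissible_3 le_Suc_eq dest: admissible_le)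

lemma power_sums_insert:
  "power_sums n (insert k K) m = {psum n js k | js. admissible (length k) m js} \<union> power_sums n K m"
  by (auto simp: power_sums_def)

lemma power_sums_empty: "power_sums n {} m = {}"
  by (simp add: power_sums_def)

lemma tr_pair:
  "tr n [r, 0] = psum n [1] [r]"
  "tr n [0, r] = psum n [2] [r]"
  "a \<noteq> 0 \<Longrightarrow> b \<noteq> 0 \<Longrightarrow> tr n [a, b] = psum n [1, 2] [a, b]"
  by (simp_all add: tr_eq_psum psum_def numeral_2_eq_2)

lemma tr_triple: "tr n [a, b, c] = psum n [1, 2, 3] [a, b, c]"
  by (simp add: tr_eq_psum numeral_3_eq_3 numeral_2_eq_2)

lemma disj_comprehension:
  "{f x | x. x = a \<or> P x} = insert (f a) {f x | x. P x}" "{f x | x. x = a} = {f a}"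
  by auto

lemma interval_simps: "{1..2} = {1, 2::nat}" "{1..3} = {1, 2, 3::nat}" "{1..4} = {1, 2, 3, 4::nat}"
  by auto

text \<open>
  Expanding in one step gives all the sets a uniform description. It covers \<open>n = 4\<close>, \<open>m = 2\<close> as well,
  because \<open>tr(1,1,1)\<close> has no instance on two rows.
\<close>

lemma T_set_eq_power_sums:
  assumes "n \<in> {2, 3, 4}" and "m \<ge> 2"
  shows "(T_set n m :: 'a::comm_ring_1 vpoly set) = power_sums n (exps n) m"
proof -
  define K :: "nat list set" where
    "K = {[1], [2], [3], [4], [1, 1], [2, 1], [1, 2], [3, 1]}"
  have exps4: "exps 4 = insert [1, 1, 1] K" by (auto simp: K_def exps_def)
  have rows_2: "admissible (Suc 0) 2 js \<longleftrightarrow> js = [1] \<or> js = [2]"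
    "admissible (Suc (Suc 0)) 2 js \<longleftrightarrow> js = [1, 2]" for js
    using admissible_small(2,5) by (simp_all add: numeral_2_eq_2)
  have rows_3: "admissible (Suc (Suc (Suc 0))) 3 js \<longleftrightarrow> js = [1, 2, 3]" for js
    using admissible_small(9) by (simp add: numeral_3_eq_3)
  note expand = power_sums_insert power_sums_empty rows_2 disj_comprehension tr_pair
  have T22: "(T22 :: 'a vpoly set) = power_sums 2 (exps 2) 2"
    unfolding T22_def interval_simps exps_def by (auto simp: expand)
  have T32: "(T32 :: 'a vpoly set) = power_sums 3 (exps 3) 2"
    unfolding T32_def interval_simps exps_def by (auto simp: expand)
  have T42: "(T42 :: 'a vpoly set) = power_sums 4 K 2"
    unfolding T42_def interval_simps K_def by (auto simp: expand)
  have T43: "(T43 :: 'a vpoly set) = power_sums 4 (exps 4) 3"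
    unfolding T43_def T42 exps4 power_sums_insert
    by (subst expansion_power_sums) (auto simp: K_def rows_3 tr_triple)
  have no_triple: "power_sums 4 (exps 4) 2 = (power_sums 4 K 2 :: 'a vpoly set)"
    unfolding exps4 power_sums_insert by (auto dest: admissible_le)
  have "expansion 2 m (power_sums n (exps n) 2) = (power_sums n (exps n) m :: 'a vpoly set)"
    if "n = 2 \<or> n = 3"
    using that assms(2) by (intro expansion_power_sums) (auto simp: exps_def)
  moreover have "expansion 3 m (power_sums 4 (exps 4) 3) = (power_sums 4 (exps 4) m :: 'a vpoly set)"
    if "m \<ge> 4"
    using that by (intro expansion_power_sums) (auto simp: exps_def)
  moreover have "m = 2 \<or> m = 3 \<or> m \<ge> 4" using assms(2) by auto
  ultimately show ?thesis
    using assms(1) unfolding T_set_def T22 T32 T42 T43 no_triple[symmetric] by auto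
qed


lemma power_sums_subset_invariants: "power_sums n K m \<subseteq> invariants n m"
  by (auto simp: power_sums_def admissible_def intro!: psum_in_invariants)


section \<open>Multisets with equal power sums\<close>

text \<open>
  The reciprocal of the polynomial with root multiset \<open>A\<close>: its \<open>k\<close>-th coefficient is, up to sign, the
  \<open>k\<close>-th elementary symmetric function of \<open>A\<close>.
\<close>

definition recip_poly :: "'a::field multiset \<Rightarrow> 'a poly"
  where "recip_poly A = (\<Prod>a\<in>#A. [:1, - a:])"

lemma recip_poly_add_mset: "recip_poly (add_mset a A) = [:1, - a:] * recip_poly A"
  by (simp add: recip_poly_def)

text \<open>
  The logarithmic derivative of the product: each factor \<open>1 - a X\<close> contributes
  \<open>- a / (1 - a X)\<close>, a geometric series.
\<close>

lemma fps_deriv_recip_poly: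
  "fps_deriv (fps_of_poly (recip_poly A)) =
    - fps_of_poly (recip_poly A) * Abs_fps (\<lambda>k. \<Sum>a\<in>#A. a ^ Suc k)"
proof (induction A)
  case empty
  then show ?case by (simp add: recip_poly_def fps_zero_def[symmetric])
next
  case (add a A)
  define g where "g = Abs_fps (\<lambda>k. a ^ Suc k)"
  define L where "L = Abs_fps (\<lambda>k. \<Sum>a\<in>#A. a ^ Suc k)"
  have geom: "(1 - fps_const a * fps_X) * g = fps_const a"
  proof (rule fps_ext)
    fix k show "fps_nth ((1 - fps_const a * fps_X) * g) k = fps_nth (fps_const a) k"
      by (cases k) (simp_all add: g_def algebra_simps fps_mult_left_const_nth mult.assoc
          del: fps_const_neg)
  qed
  have lin: "fps_of_poly [:1, - a:] = 1 - fps_const a * fps_X"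
    by (simp add: fps_of_poly_linear' flip: fps_const_neg)
  have split: "Abs_fps (\<lambda>k. \<Sum>b\<in>#add_mset a A. b ^ Suc k) = g + L"
    by (rule fps_ext) (simp add: g_def L_def)
  have "fps_deriv (fps_of_poly (recip_poly (add_mset a A))) =
      - fps_const a * fps_of_poly (recip_poly A) +
      (1 - fps_const a * fps_X) * (- fps_of_poly (recip_poly A) * L)"
    using add.IH by (simp only: recip_poly_add_mset fps_of_poly_mult lin L_def fps_deriv_mult) simp
  also have "\<dots> = - ((1 - fps_const a * fps_X) * fps_of_poly (recip_poly A)) * (g + L)"
  proof -
    have "P * g = b \<Longrightarrow> - b * F + P * (- F * L) = - (P * F) * (g + L)"
      for P b F :: "'a fps"
      by (auto simp: algebra_simps)
    then show ?thesis using geom .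
  qed
  also have "\<dots> = - fps_of_poly (recip_poly (add_mset a A)) * (g + L)"
    by (simp only: recip_poly_add_mset fps_of_poly_mult lin)
  finally show ?case by (simp only: split)
qed

lemma newton_identity:
  "of_nat (Suc k) * coeff (recip_poly A) (Suc k) =
    - (\<Sum>i\<le>k. coeff (recip_poly A) i * (\<Sum>a\<in>#A. a ^ Suc (k - i)))"
  using arg_cong[OF fps_deriv_recip_poly[of A], of "\<lambda>f. fps_nth f k"]
  by (simp add: fps_mult_nth atMost_atLeast0 sum_negf)

text \<open>
  Reflecting \<open>1 - a X\<close> gives \<open>X - a\<close> for \<open>a \<noteq> 0\<close>, but 1 for \<open>a = 0\<close>, so zeros leave no trace.
\<close>

lemma proots_recip_poly: "proots (reflect_poly (recip_poly A)) = filter_mset (\<lambda>a. a \<noteq> 0) A"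
proof (induction A)
  case (add a A)
  have nz: "recip_poly A \<noteq> 0"
    by (auto simp: recip_poly_def)
  have "proots (reflect_poly (recip_poly (add_mset a A))) =
      proots (reflect_poly [:1, - a:]) + proots (reflect_poly (recip_poly A))"
    using nz by (simp only: recip_poly_add_mset reflect_poly_mult) (rule proots_mult, auto)
  also have "proots (reflect_poly [:1, - a:]) = (if a = 0 then {#} else {#a#})"
    by (simp add: reflect_poly_pCons)
  finally show ?case using add.IH by simp
qed (simp add: recip_poly_def)

text \<open>
  Newton's identities determine the coefficients of the polynomial recursively, as the factors
  \<open>1, ..., N\<close> on their left-hand sides are invertible. The polynomial determines the nonzero elements,
  and the size determines the number of zeros.
\<close>

theorem multiset_eq_if_power_sums_eq:
  fixes A B :: "'a::field multiset"
  assumes size: "size A = N" "size B = N"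
    and char: "\<And>k. 0 < k \<Longrightarrow> k \<le> N \<Longrightarrow> of_nat k \<noteq> (0::'a)"
    and power_sums: "\<And>k. 0 < k \<Longrightarrow> k \<le> N \<Longrightarrow> (\<Sum>a\<in>#A. a ^ k) = (\<Sum>a\<in>#B. a ^ k)"
  shows "A = B"
proof -
  have low: "coeff (recip_poly A) k = coeff (recip_poly B) k" if "k \<le> N" for k
    using that
  proof (induction k rule: less_induct)
    case (less k)
    show ?case
    proof (cases k)
      case 0
      have "coeff (recip_poly C) 0 = 1" for C :: "'a multiset"
        by (induction C) (simp_all add: recip_poly_def)
      then show ?thesis using 0 by simp
    next
      case (Suc l)
      have "of_nat k * coeff (recip_poly A) k = of_nat k * coeff (recip_poly B) k"
        unfolding Suc newton_identity using less Suc power_sums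
        by (intro arg_cong[of _ _ uminus] sum.cong arg_cong2[of _ _ _ _ "(*)"])
          (auto simp del: power_Suc)
      then show ?thesis using char[of k] less.prems Suc by simp
    qed
  qed
  have deg: "degree (recip_poly C) \<le> size C" for C :: "'a multiset"
  proof (induction C)
    case (add a C)
    have "degree ([:1, - a:] * recip_poly C) \<le> 1 + degree (recip_poly C)"
      by (intro order_trans[OF degree_mult_le]) simp
    then show ?case using add by (simp add: recip_poly_def)
  qed (simp add: recip_poly_def)
  have "recip_poly A = recip_poly B"
  proof (rule poly_eqI)
    fix k show "coeff (recip_poly A) k = coeff (recip_poly B) k"
      using low[of k] deg[of A] deg[of B] size
      by (cases "k \<le> N") (auto simp: coeff_eq_0)
  qed
  then have nz: "filter_mset (\<lambda>a. a \<noteq> 0) A = filter_mset (\<lambda>a. a \<noteq> 0) B"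
    by (metis proots_recip_poly)
  have split: "C = filter_mset (\<lambda>a. a \<noteq> 0) C
      + replicate_mset (size C - size (filter_mset (\<lambda>a. a \<noteq> 0) C)) 0" for C :: "'a multiset"
  proof (induction C)
    case (add c C)
    then show ?case
      using size_filter_mset_lesseq[of "\<lambda>a. a \<noteq> 0" C]
      by (cases "c = 0") (auto simp: Suc_diff_le)
  qed simp
  show ?thesis using split[of A] split[of B] nz size by simp
qed

section \<open>Sums over the classes of partitions\<close>

text \<open>
  The polynomial \<open>q\<close> vanishes at all values of \<open>a\<close> other than \<open>a x\<close>, so the sum of \<open>q(a) d\<close> is a
  nonzero multiple of the class sum; its degree is so small that it only involves the given moments.
\<close>

lemma class_sums_eq_0:
  fixes a d :: "'p \<Rightarrow> 'a::field"
  assumes S: "finite S"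
    and moments: "\<And>k. k < card (a ` S) \<Longrightarrow> (\<Sum>i\<in>S. a i ^ k * d i) = 0"
    and "x \<in> S"
  shows "(\<Sum>i | i \<in> S \<and> a i = a x. d i) = 0"
proof -
  define q where "q = (\<Prod>t\<in>a ` S - {a x}. [:- t, 1:])"
  have "degree q \<le> (\<Sum>t\<in>a ` S - {a x}. degree [:- t, 1:])"
    unfolding q_def by (rule degree_prod_sum_le[unfolded o_def]) (use S in simp)
  also have "\<dots> < card (a ` S)"
    using S \<open>x \<in> S\<close> card_Diff1_less[of "a ` S" "a x"] by simp
  finally have deg: "degree q < card (a ` S)" .
  have "(\<Sum>i\<in>S. poly q (a i) * d i) = (\<Sum>i\<in>S. \<Sum>k\<le>degree q. coeff q k * (a i ^ k * d i))"
    by (simp add: poly_altdef sum_distrib_right mult.assoc)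
  also have "\<dots> = (\<Sum>k\<le>degree q. coeff q k * (\<Sum>i\<in>S. a i ^ k * d i))"
    by (subst sum.swap) (simp add: sum_distrib_left)
  also have "\<dots> = 0"
    using moments deg by simp
  finally have "0 = (\<Sum>i\<in>S. poly q (a i) * d i)" by simp
  also have "\<dots> = (\<Sum>i | i \<in> S \<and> a i = a x. poly q (a i) * d i)"
    using S by (intro sum.mono_neutral_right) (auto simp: q_def poly_prod prod_zero_iff)
  also have "\<dots> = poly q (a x) * (\<Sum>i | i \<in> S \<and> a i = a x. d i)"
    by (simp add: sum_distrib_left)
  finally have "poly q (a x) * (\<Sum>i | i \<in> S \<and> a i = a x. d i) = 0" by simp
  moreover have "poly q (a x) \<noteq> 0"
    using S by (auto simp: q_def poly_prod prod_zero_iff)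
  ultimately show ?thesis by simp
qed

text \<open>
  The partitions of four points into the level sets of \<open>f\<close> and \<open>g\<close> are \<open>pq|rs\<close> and \<open>pr|qs\<close>.
\<close>

definition crossing :: "'p set \<Rightarrow> ('p \<Rightarrow> 'b) \<Rightarrow> ('p \<Rightarrow> 'c) \<Rightarrow> bool"
  where "crossing S f g \<longleftrightarrow> (\<exists>p q r s. S = {p, q, r, s} \<and> card S = 4 \<and>
    f p = f q \<and> f r = f s \<and> f p \<noteq> f r \<and> g p = g r \<and> g q = g s \<and> g p \<noteq> g q)"

text \<open>
  Split \<open>S\<close> into four blocks according to membership in the \<open>f\<close>-class and the \<open>g\<close>-class of \<open>x\<close>. The
  sums over the blocks are \<open>t\<close>, \<open>-t\<close>, \<open>-t\<close>, \<open>t\<close>, so \<open>t = 0\<close> as soon as one block is empty. Otherwise all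
  four blocks are singletons, and if \<open>f\<close> and \<open>g\<close> do not cross, the point opposite to \<open>x\<close> forms a class
  of its own for one of them.
\<close>

lemma joint_class_sums_eq_0:
  fixes D :: "'p \<Rightarrow> 'd::ab_group_add"
  assumes S: "finite S" "card S \<le> 4"
    and f: "\<And>x. x \<in> S \<Longrightarrow> (\<Sum>i | i \<in> S \<and> f i = f x. D i) = 0"
    and g: "\<And>x. x \<in> S \<Longrightarrow> (\<Sum>i | i \<in> S \<and> g i = g x. D i) = 0"
    and total: "(\<Sum>i\<in>S. D i) = 0"
    and not_crossing: "\<not> crossing S f g"
    and "x \<in> S"
  shows "(\<Sum>i | i \<in> S \<and> f i = f x \<and> g i = g x. D i) = 0"
proof -
  define C where "C = {i \<in> S. f i = f x \<and> g i = g x}"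
  define A where "A = {i \<in> S. f i = f x \<and> g i \<noteq> g x}"
  define B where "B = {i \<in> S. f i \<noteq> f x \<and> g i = g x}"
  define E where "E = {i \<in> S. f i \<noteq> f x \<and> g i \<noteq> g x}"
  have fin: "finite C" "finite A" "finite B" "finite E"
    using S by (simp_all add: C_def A_def B_def E_def)
  have disj: "C \<inter> A = {}" "C \<inter> B = {}" "A \<inter> B = {}" "(C \<union> A \<union> B) \<inter> E = {}"
    by (auto simp: C_def A_def B_def E_def)
  have S_eq: "S = C \<union> A \<union> B \<union> E"
    by (auto simp: C_def A_def B_def E_def)
  have "{i \<in> S. f i = f x} = C \<union> A" "{i \<in> S. g i = g x} = C \<union> B"
    by (auto simp: C_def A_def B_def)
  then have CA: "sum D C + sum D A = 0" and CB: "sum D C + sum D B = 0"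
    using f[OF \<open>x \<in> S\<close>] g[OF \<open>x \<in> S\<close>] fin disj by (simp_all add: sum.union_disjoint)
  have CE: "sum D C = sum D E"
  proof -
    have "sum D C + sum D A + sum D B + sum D E = 0"
      using total fin disj unfolding S_eq
      by (simp add: sum.union_disjoint Int_Un_distrib2)
    then show ?thesis using CA CB
      by (metis add.commute add.left_neutral add_left_imp_eq)
  qed
  show ?thesis
  proof (cases "A = {} \<or> B = {} \<or> E = {}")
    case True
    then show ?thesis using CA CB CE by (auto simp: C_def)
  next
    case False
    have "x \<in> C" using \<open>x \<in> S\<close> by (simp add: C_def)
    then have pos: "card A \<ge> 1" "card B \<ge> 1" "card C \<ge> 1" "card E \<ge> 1"
      using False fin by (auto simp: Suc_le_eq card_gt_0_iff)
    have "card S = card C + card A + card B + card E"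
      using fin disj unfolding S_eq by (simp add: card_Un_disjoint Int_Un_distrib2)
    then have ones: "card A = 1" "card B = 1" "card C = 1" "card E = 1" and "card S = 4"
      using pos S by linarith+
    obtain q r s where q: "A = {q}" and r: "B = {r}" and s: "E = {s}"
      using ones by (meson card_1_singletonE)
    have C: "C = {x}" using \<open>x \<in> C\<close> ones by (metis card_1_singletonE singletonD)
    have S4: "S = {x, q, r, s}" using S_eq C q r s by auto
    have vals: "f q = f x" "g q \<noteq> g x" "f r \<noteq> f x" "g r = g x" "f s \<noteq> f x" "g s \<noteq> g x"
      using q r s by (auto simp: A_def B_def E_def)
    have "f s \<noteq> f r \<or> g s \<noteq> g q"
    proof (rule ccontr)
      assume "\<not> ?thesis"
      with vals S4 \<open>card S = 4\<close> have "crossing S f g" unfolding crossing_def by metis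
      with not_crossing show False ..
    qed
    then have "{i \<in> S. f i = f s} = {s} \<or> {i \<in> S. g i = g s} = {s}"
      using S4 vals by auto
    then have "D s = 0"
      using f[of s] g[of s] S4 by auto
    then show ?thesis using CE s by (simp add: C_def)
  qed
qed


section \<open>Reconstruction of an orbit from power sums\<close>

lemma sum_eq_if_image_mset_eq:
  assumes "image_mset c (mset_set C) = image_mset c' (mset_set C)"
  shows "(\<Sum>i\<in>C. h (c i)) = (\<Sum>i\<in>C. h (c' i))"
  using arg_cong[OF assms, of "\<lambda>A. \<Sum>a\<in>#A. h a"]
  by (simp add: sum_unfold_sum_mset image_mset.compositionality o_def)

text \<open>
  By \<open>multiset_eq_if_power_sums_eq\<close> it is enough to compare the power sums over the class \<open>C\<close> of \<open>x\<close>
  up to exponent \<open>card C\<close>. If all points outside \<open>C\<close> are singleton classes, then \<open>c\<close> and \<open>c'\<close> agree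
  there, and the power sums over \<open>S\<close> can be used. The only other case that needs more than exponent 1
  is a partition of four points into two pairs.
\<close>

lemma class_mset_eq:
  fixes a c c' :: "'p \<Rightarrow> 'a::field"
  assumes S: "finite S" "card S = n" "n \<le> 4"
    and char: "\<And>k. 0 < k \<Longrightarrow> k \<le> n \<Longrightarrow> of_nat k \<noteq> (0::'a)"
    and linear: "\<And>k. k < n \<Longrightarrow> (\<Sum>i\<in>S. a i ^ k * c i) = (\<Sum>i\<in>S. a i ^ k * c' i)"
    and marginal: "\<And>k. 0 < k \<Longrightarrow> k \<le> n \<Longrightarrow> (\<Sum>i\<in>S. c i ^ k) = (\<Sum>i\<in>S. c' i ^ k)"
    and square: "n = 4 \<Longrightarrow> (\<Sum>i\<in>S. a i * c i ^ 2) = (\<Sum>i\<in>S. a i * c' i ^ 2)"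
    and "x \<in> S"
  shows "image_mset c (mset_set {i \<in> S. a i = a x}) = image_mset c' (mset_set {i \<in> S. a i = a x})"
proof -
  define C where "C = {i \<in> S. a i = a x}"
  have C: "finite C" "C \<subseteq> S" "card C \<le> n"
    using S by (auto simp: C_def intro: card_mono)
  have class_sum: "(\<Sum>i | i \<in> S \<and> a i = a y. c i) = (\<Sum>i | i \<in> S \<and> a i = a y. c' i)"
    if "y \<in> S" for y
  proof -
    have "card (a ` S) \<le> n" using S card_image_le by blast
    then have "(\<Sum>i | i \<in> S \<and> a i = a y. c i - c' i) = 0"
      using S linear that by (intro class_sums_eq_0) (auto simp: algebra_simps sum_subtractf)
    then show ?thesis by (simp add: sum_subtractf)
  qed
  have "(\<Sum>i\<in>C. c i ^ k) = (\<Sum>i\<in>C. c' i ^ k)" if k: "0 < k" "k \<le> card C" for k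
  proof (cases "\<exists>y z. y \<in> S - C \<and> z \<in> S - C \<and> y \<noteq> z \<and> a y = a z")
    case False
    have "c y = c' y" if "y \<in> S - C" for y
    proof -
      have "{i \<in> S. a i = a y} = {y}" using that False by (auto simp: C_def)
      then show ?thesis using class_sum[of y] that by simp
    qed
    then have "(\<Sum>i\<in>S - C. c i ^ k) = (\<Sum>i\<in>S - C. c' i ^ k)" by simp
    then show ?thesis
      using marginal[of k] k C sum.subset_diff[OF C(2) S(1), of "\<lambda>i. c i ^ k"]
        sum.subset_diff[OF C(2) S(1), of "\<lambda>i. c' i ^ k"] by simp
  next
    case True
    then obtain y z where yz: "y \<in> S - C" "z \<in> S - C" "y \<noteq> z" "a y = a z" by blast
    show ?thesis
    proof (cases "k = 1")
      case True
      then show ?thesis using class_sum[OF \<open>x \<in> S\<close>] by (simp add: C_def)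
    next
      case False
      \<comment> \<open>The class C of size at least 2 and the class of y and z fill up S.\<close>
    have "card {y, z} \<le> card (S - C)"
        using yz S by (intro card_mono) auto
      then have "card C + 2 \<le> n"
        using yz S C by (simp add: card_Diff_subset)
      then have n: "n = 4" "k = 2" "card C = 2"
        using k False S by linarith+
      then have "{y, z} = S - C"
        using yz S C by (intro card_subset_eq) (auto simp: card_Diff_subset)
      then have "i \<in> C \<or> i \<in> {y, z}" if "i \<in> S" for i
        using that by blast
      then have "a ` S \<subseteq> {a x, a y}"
        using yz(4) by (auto simp: C_def)
      \<comment> \<open>With only two values of a, the moments of order 0 and 1 suffice.\<close>
      then have "card (a ` S) \<le> card {a x, a y}"
        by (intro card_mono) simp_all
      also have "\<dots> \<le> 2" by (simp add: card_insert_if)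
      finally have "card (a ` S) \<le> 2" .
      have "(\<Sum>i\<in>S. a i ^ l * (c i ^ 2 - c' i ^ 2)) = 0" if "l < card (a ` S)" for l
      proof -
        have "l = 0 \<or> l = 1" using that \<open>card (a ` S) \<le> 2\<close> by linarith
        then show ?thesis
          using marginal[of 2] square n by (elim disjE) (simp_all add: right_diff_distrib sum_subtractf)
      qed
      then have "(\<Sum>i | i \<in> S \<and> a i = a x. c i ^ 2 - c' i ^ 2) = 0"
        using S \<open>x \<in> S\<close> by (intro class_sums_eq_0)
      then show ?thesis by (simp add: sum_subtractf n C_def)
    qed
  qed
  then have "image_mset c (mset_set C) = image_mset c' (mset_set C)"
    using char C by (intro multiset_eq_if_power_sums_eq[where N = "card C"])
      (auto simp: image_mset.compositionality o_def simp flip: sum_unfold_sum_mset)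
  then show ?thesis by (simp add: C_def)
qed

text \<open>
  Induction over \<open>J\<close>, adding one partition at a time. A crossing of the common refinement of some rows
  with a further row is already a crossing of one of those rows with it.
\<close>

lemma joint_class_sums_eq_0_family:
  fixes D :: "'p \<Rightarrow> 'd::ab_group_add" and u :: "'r \<Rightarrow> 'p \<Rightarrow> 'b"
  assumes S: "finite S" "card S \<le> 4" and "finite J"
    and classes: "\<And>j x. j \<in> J \<Longrightarrow> x \<in> S \<Longrightarrow> (\<Sum>i | i \<in> S \<and> u j i = u j x. D i) = 0"
    and total: "(\<Sum>i\<in>S. D i) = 0"
    and not_crossing: "\<And>j k. j \<in> J \<Longrightarrow> k \<in> J \<Longrightarrow> \<not> crossing S (u j) (u k)"
    and "x \<in> S"
  shows "(\<Sum>i | i \<in> S \<and> (\<forall>j\<in>J. u j i = u j x). D i) = 0"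
  using \<open>finite J\<close> classes not_crossing \<open>x \<in> S\<close>
proof (induction J arbitrary: x)
  case empty
  then show ?case using total by simp
next
  case (insert l J)
  define f where "f i = restrict (\<lambda>j. u j i) J" for i
  have f_eq: "f i = f y \<longleftrightarrow> (\<forall>j\<in>J. u j i = u j y)" for i y
    by (auto simp: f_def restrict_def fun_eq_iff)
  have "\<not> crossing S f (u l)"
  proof
    assume "crossing S f (u l)"
    then obtain p q r s where *: "S = {p, q, r, s}" "card S = 4" "f p = f q" "f r = f s"
      "f p \<noteq> f r" "u l p = u l r" "u l q = u l s" "u l p \<noteq> u l q"
      unfolding crossing_def by blast
    then obtain j where "j \<in> J" "u j p \<noteq> u j r" by (auto simp: f_eq)
    with * have "crossing S (u j) (u l)" unfolding crossing_def f_eq by metis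
    with \<open>j \<in> J\<close> insert.prems show False by blast
  qed
  then have "(\<Sum>i | i \<in> S \<and> f i = f x \<and> u l i = u l x. D i) = 0"
    using S total insert.prems insert.IH
    by (intro joint_class_sums_eq_0) (simp_all add: f_eq)
  then show ?case by (simp add: f_eq conj_commute)
qed

text \<open>
  If two aligned rows cross, the columns are pairwise distinct already and \<open>c = c'\<close> is forced. Otherwise
  \<open>joint_class_sums_eq_0_family\<close>, applied to differences of indicator functions of values, shows that
  the columns extended by \<open>c\<close> and those extended by \<open>c'\<close> form the same multiset.
\<close>

lemma align_next_row:
  fixes c c' :: "'p \<Rightarrow> 'a::field" and u :: "'r \<Rightarrow> 'p \<Rightarrow> 'a"
  assumes S: "finite S" "card S \<le> 4" and "finite J"
    and classes: "\<And>j x. j \<in> J \<Longrightarrow> x \<in> S \<Longrightarrow> image_mset c (mset_set {i \<in> S. u j i = u j x}) =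
      image_mset c' (mset_set {i \<in> S. u j i = u j x})"
    and total: "image_mset c (mset_set S) = image_mset c' (mset_set S)"
    and triple: "\<And>j k. card S = 4 \<Longrightarrow> j \<in> J \<Longrightarrow> k \<in> J \<Longrightarrow> j \<noteq> k \<Longrightarrow>
      (\<Sum>i\<in>S. u j i * u k i * c i) = (\<Sum>i\<in>S. u j i * u k i * c' i)"
  shows "\<exists>\<sigma>. \<sigma> permutes S \<and> (\<forall>i\<in>S. c' i = c (\<sigma> i) \<and> (\<forall>j\<in>J. u j i = u j (\<sigma> i)))"
proof (cases "\<exists>j\<in>J. \<exists>k\<in>J. crossing S (u j) (u k)")
  case True
  then obtain j k p q r s where jk: "j \<in> J" "k \<in> J" and S4: "S = {p, q, r, s}" "card S = 4"
    and j: "u j p = u j q" "u j r = u j s" "u j p \<noteq> u j r"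
    and k: "u k p = u k r" "u k q = u k s" "u k p \<noteq> u k q"
    unfolding crossing_def by blast
  have dist: "distinct [p, q, r, s]"
    using S4 by (intro card_distinct) simp
  define d where "d i = c i - c' i" for i
  have class_d: "(\<Sum>i | i \<in> S \<and> u l i = u l x. d i) = 0" if "l \<in> J" "x \<in> S" for l x
    using sum_eq_if_image_mset_eq[OF classes[OF that], of "\<lambda>t. t"] by (simp add: d_def sum_subtractf)
  have "{i \<in> S. u j i = u j p} = {p, q}" "{i \<in> S. u j i = u j r} = {r, s}"
    "{i \<in> S. u k i = u k p} = {p, r}"
    using S4 j k by auto
  then have sums: "d p + d q = 0" "d r + d s = 0" "d p + d r = 0"
    using class_d[of j p] class_d[of j r] class_d[of k p] jk S4 dist by simp_all
  have "j \<noteq> k" using j k by auto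
  then have "(\<Sum>i\<in>S. u j i * u k i * d i) = 0"
    using triple[of j k] S4 jk by (simp add: d_def right_diff_distrib sum_subtractf)
  then have "u j p * u k p * d p + u j q * u k q * d q + u j r * u k r * d r + u j s * u k s * d s = 0"
    using dist by (simp add: S4 algebra_simps)
  moreover have "d q = - d p" "d r = - d p" "d s = d p"
    using sums by (simp_all add: add_eq_0_iff)
  ultimately have "(u j p - u j r) * (u k p - u k q) * d p = 0"
    using j k by (simp add: algebra_simps)
  then have "d p = 0" using j k by simp
  then have "\<forall>i\<in>S. c i = c' i"
    using \<open>d q = - d p\<close> \<open>d r = - d p\<close> \<open>d s = d p\<close> S4 by (auto simp: d_def)
  then show ?thesis by (intro exI[of _ id]) (simp add: permutes_id flip: id_def)
next
  case False
  define f where "f i = restrict (\<lambda>j. u j i) J" for i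
  have f_eq: "f i = f y \<longleftrightarrow> (\<forall>j\<in>J. u j i = u j y)" for i y
    by (auto simp: f_def restrict_def fun_eq_iff)
  have card_eq: "card {i \<in> S. f i = f x \<and> c i = t} = card {i \<in> S. f i = f x \<and> c' i = t}"
    if "x \<in> S" for x t
  proof -
    \<comment> \<open>Integer weights count points exactly, whatever the characteristic of the field.\<close>
    define D :: "'p \<Rightarrow> int" where "D i = of_bool (c i = t) - of_bool (c' i = t)" for i
    have "(\<Sum>i | i \<in> S \<and> (\<forall>j\<in>J. u j i = u j x). D i) = 0"
      using S \<open>finite J\<close> False that
        sum_eq_if_image_mset_eq[OF classes, of _ _ "\<lambda>b. of_bool (b = t) :: int"]
        sum_eq_if_image_mset_eq[OF total, of "\<lambda>b. of_bool (b = t) :: int"]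
      by (intro joint_class_sums_eq_0_family) (simp_all add: D_def sum_subtractf)
    then have "(\<Sum>i | i \<in> S \<and> f i = f x. of_bool (c i = t) :: int) =
        (\<Sum>i | i \<in> S \<and> f i = f x. of_bool (c' i = t))"
      by (simp add: D_def sum_subtractf f_eq)
    then show ?thesis
      using S by (simp add: sum_of_bool_eq Int_def conj_assoc)
  qed
  have pairs: "image_mset (\<lambda>i. (f i, c' i)) (mset_set S) = image_mset (\<lambda>i. (f i, c i)) (mset_set S)"
  proof (rule multiset_eqI)
    fix y :: "('r \<Rightarrow> 'a) \<times> 'a"
    obtain z t where y: "y = (z, t)" by (cases y)
    have count: "count (image_mset (\<lambda>i. (f i, b i)) (mset_set S)) y =
        card {i \<in> S. f i = z \<and> b i = t}" for b :: "'p \<Rightarrow> 'a"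
    proof -
      have "count (image_mset (\<lambda>i. (f i, b i)) (mset_set S)) y = (\<Sum>i | i \<in> S \<and> f i = z \<and> b i = t. 1)"
        unfolding count_image_mset' y using S by (intro sum.cong) auto
      then show ?thesis by simp
    qed
    show "count (image_mset (\<lambda>i. (f i, c' i)) (mset_set S)) y =
        count (image_mset (\<lambda>i. (f i, c i)) (mset_set S)) y"
    proof (cases "\<exists>x\<in>S. f x = z")
      case True
      then show ?thesis unfolding count using card_eq by auto
    next
      case False
      then have "{i \<in> S. f i = z \<and> b i = t} = {}" for b :: "'p \<Rightarrow> 'a" by blast
      then show ?thesis unfolding count by (simp only:)
    qed
  qed
  obtain \<sigma> where "\<sigma> permutes S" "\<forall>i\<in>S. (f i, c' i) = (f (\<sigma> i), c (\<sigma> i))"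
    by (rule image_mset_eq_implies_permutes[OF S(1) pairs]) blast
  then show ?thesis by (intro exI[of _ \<sigma>]) (auto simp: f_eq)
qed

theorem same_orbit_if_power_sums_eq:
  fixes u v :: "nat \<Rightarrow> nat \<Rightarrow> 'a::field"
  assumes n: "0 < n" "n \<le> 4"
    and char: "\<And>k. 0 < k \<Longrightarrow> k \<le> n \<Longrightarrow> of_nat k \<noteq> (0::'a)"
    and single: "\<And>j r. j \<in> {1..m} \<Longrightarrow> 0 < r \<Longrightarrow> r \<le> n \<Longrightarrow>
      (\<Sum>i=1..n. u j i ^ r) = (\<Sum>i=1..n. v j i ^ r)"
    and linear: "\<And>j k r. 1 \<le> j \<Longrightarrow> j < k \<Longrightarrow> k \<le> m \<Longrightarrow> 0 < r \<Longrightarrow> r < n \<Longrightarrow>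
      (\<Sum>i=1..n. u j i ^ r * u k i) = (\<Sum>i=1..n. v j i ^ r * v k i)"
    and square: "\<And>j k. n = 4 \<Longrightarrow> 1 \<le> j \<Longrightarrow> j < k \<Longrightarrow> k \<le> m \<Longrightarrow>
      (\<Sum>i=1..n. u j i * u k i ^ 2) = (\<Sum>i=1..n. v j i * v k i ^ 2)"
    and triple: "\<And>j k l. n = 4 \<Longrightarrow> 1 \<le> j \<Longrightarrow> j < k \<Longrightarrow> k < l \<Longrightarrow> l \<le> m \<Longrightarrow>
      (\<Sum>i=1..n. u j i * u k i * u l i) = (\<Sum>i=1..n. v j i * v k i * v l i)"
  shows "\<exists>\<sigma>. \<sigma> permutes {1..n} \<and> (\<forall>j\<in>{1..m}. \<forall>i\<in>{1..n}. v j i = u j (\<sigma> i))"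
proof -
  define S where "S = {1..n}"
  have S: "finite S" "card S = n" by (simp_all add: S_def)
  have "\<exists>\<sigma>. \<sigma> permutes S \<and> (\<forall>j\<in>{1..l}. \<forall>i\<in>S. v j i = u j (\<sigma> i))" if "l \<le> m" for l
    using that
  proof (induction l)
    case 0
    show ?case by (intro exI[of _ id]) (simp add: permutes_id flip: id_def)
  next
    case (Suc l)
    then obtain \<sigma> where \<sigma>: "\<sigma> permutes S" and aligned: "\<And>j i. j \<in> {1..l} \<Longrightarrow> i \<in> S \<Longrightarrow> v j i = u j (\<sigma> i)"
      by auto
    \<comment> \<open>The rows of u are permuted by sigma; on the first l rows they then coincide with v.\<close>
    define c where "c i = u (Suc l) (\<sigma> i)" for i
    have perm: "(\<Sum>i\<in>S. h (\<sigma> i)) = (\<Sum>i\<in>S. h i)" for h :: "nat \<Rightarrow> 'a"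
      using sum.permute[OF \<sigma>, of h] by (simp add: o_def)
    have c_powers: "(\<Sum>i\<in>S. c i ^ r) = (\<Sum>i\<in>S. v (Suc l) i ^ r)" if "0 < r" "r \<le> n" for r
      using single[of "Suc l" r] that Suc.prems perm[of "\<lambda>i. u (Suc l) i ^ r"]
      by (simp add: S_def c_def)
    have "\<exists>\<tau>. \<tau> permutes S \<and> (\<forall>i\<in>S. v (Suc l) i = c (\<tau> i) \<and> (\<forall>j\<in>{1..l}. v j i = v j (\<tau> i)))"
    proof (rule align_next_row)
      show "finite S" "card S \<le> 4" "finite {1..l}" using S n by simp_all
      show "image_mset c (mset_set {i \<in> S. v j i = v j x}) =
          image_mset (v (Suc l)) (mset_set {i \<in> S. v j i = v j x})"
        if j: "j \<in> {1..l}" and "x \<in> S" for j x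
      proof (rule class_mset_eq[OF S n(2) char])
        show "(\<Sum>i\<in>S. v j i ^ k * c i) = (\<Sum>i\<in>S. v j i ^ k * v (Suc l) i)" if "k < n" for k
        proof (cases "k = 0")
          case True
          then show ?thesis using c_powers[of 1] n by simp
        next
          case False
          then show ?thesis
            using linear[of j "Suc l" k] that j Suc.prems aligned[OF j]
              perm[of "\<lambda>i. u j i ^ k * u (Suc l) i"]
            by (simp add: S_def c_def)
        qed
        show "(\<Sum>i\<in>S. v j i * c i ^ 2) = (\<Sum>i\<in>S. v j i * v (Suc l) i ^ 2)" if "n = 4"
          using square[of j "Suc l"] that j Suc.prems aligned[OF j]
            perm[of "\<lambda>i. u j i * u (Suc l) i ^ 2"]
          by (simp add: S_def c_def)
      qed (use c_powers \<open>x \<in> S\<close> in auto)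
      show "image_mset c (mset_set S) = image_mset (v (Suc l)) (mset_set S)"
        using char S c_powers by (intro multiset_eq_if_power_sums_eq[where N = n])
          (auto simp: image_mset.compositionality o_def simp flip: sum_unfold_sum_mset)
      show "(\<Sum>i\<in>S. v j i * v k i * c i) = (\<Sum>i\<in>S. v j i * v k i * v (Suc l) i)"
        if "card S = 4" and jk: "j \<in> {1..l}" "k \<in> {1..l}" "j \<noteq> k" for j k
      proof -
        have "(\<Sum>i\<in>S. v j i * v k i * c i) = (\<Sum>i\<in>S. v j i * v k i * v (Suc l) i)"
          if jk: "j \<in> {1..l}" "k \<in> {1..l}" "j < k" for j k
          using triple[of j k "Suc l"] S \<open>card S = 4\<close> jk Suc.prems aligned[OF jk(1)] aligned[OF jk(2)]
            perm[of "\<lambda>i. u j i * u k i * u (Suc l) i"]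
          by (simp add: S_def c_def)
        from this[of j k] this[of k j] show ?thesis
          using jk by (cases "j < k") (auto simp: mult.commute)
      qed
    qed
    then obtain \<tau> where \<tau>: "\<tau> permutes S" "\<And>i. i \<in> S \<Longrightarrow> v (Suc l) i = c (\<tau> i)"
      "\<And>i j. i \<in> S \<Longrightarrow> j \<in> {1..l} \<Longrightarrow> v j i = v j (\<tau> i)" by blast
    have "v j i = u j (\<sigma> (\<tau> i))" if "j \<in> {1..Suc l}" "i \<in> S" for j i
    proof (cases "j = Suc l")
      case True
      then show ?thesis using \<tau> that by (simp add: c_def)
    next
      case False
      then have "j \<in> {1..l}" using that by auto
      moreover have "\<tau> i \<in> S" using \<tau>(1) that by (simp add: permutes_in_image)
      ultimately show ?thesis using \<tau>(3) aligned that by metis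
    qed
    with permutes_compose[OF \<tau>(1) \<sigma>] show ?case
      by (intro exI[of _ "\<sigma> \<circ> \<tau>"] conjI) (assumption, simp)
  qed
  from this[OF order.refl] show ?thesis by (simp add: S_def)
qed

text \<open>
  Each hypothesis of \<open>same_orbit_if_power_sums_eq\<close> is the equality of the values of one of the listed
  power sums.
\<close>

lemma separating_power_sums:
  assumes n: "n \<in> {2, 3, 4}"
    and char: "\<And>r. 0 < r \<Longrightarrow> r \<le> n \<Longrightarrow> of_nat r \<noteq> (0::'a::field)"
  shows "separating n m (power_sums n (exps n) m :: 'a vpoly set)"
  unfolding separating_def
proof (intro conjI ballI impI power_sums_subset_invariants)
  fix u v :: "nat \<Rightarrow> nat \<Rightarrow> 'a"
  assume sep: "separated_by (invariants n m) u v"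
  show "separated_by (power_sums n (exps n) m) u v"
  proof (rule ccontr)
    assume not_sep: "\<not> ?thesis"
    have eq: "(\<Sum>i=1..n. \<Prod>l<length k. u (js ! l) i ^ (k ! l)) =
        (\<Sum>i=1..n. \<Prod>l<length k. v (js ! l) i ^ (k ! l))"
      if "k \<in> exps n" "admissible (length k) m js" for k js
      using not_sep that unfolding separated_by_def power_sums_def eval_at_psum[symmetric] by blast
    have "\<exists>\<sigma>. \<sigma> permutes {1..n} \<and> (\<forall>j\<in>{1..m}. \<forall>i\<in>{1..n}. v j i = u j (\<sigma> i))"
    proof (rule same_orbit_if_power_sums_eq[OF _ _ char])
      show "0 < n" "n \<le> 4" using n by auto
      show "(\<Sum>i=1..n. u j i ^ r) = (\<Sum>i=1..n. v j i ^ r)" if "j \<in> {1..m}" "0 < r" "r \<le> n" for j r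
      proof -
        have "r = 1 \<or> r = 2 \<or> r = 3 \<or> r = 4" using that n by auto
        then have "[r] \<in> exps n" using that n by (auto simp: exps_def)
        then show ?thesis using eq[of "[r]" "[j]"] that by (simp add: admissible_1)
      qed
      show "(\<Sum>i=1..n. u j i ^ r * u k i) = (\<Sum>i=1..n. v j i ^ r * v k i)"
        if "1 \<le> j" "j < k" "k \<le> m" "0 < r" "r < n" for j k r
      proof -
        have "r = 1 \<or> r = 2 \<or> r = 3" using that n by auto
        then have "[r, 1] \<in> exps n" using that n by (auto simp: exps_def)
        then show ?thesis using eq[of "[r, 1]" "[j, k]"] that by (simp add: admissible_2)
      qed
      show "(\<Sum>i=1..n. u j i * u k i ^ 2) = (\<Sum>i=1..n. v j i * v k i ^ 2)"
        if "n = 4" "1 \<le> j" "j < k" "k \<le> m" for j k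
        using eq[of "[1, 2]" "[j, k]"] that by (simp add: admissible_2 exps_def)
      show "(\<Sum>i=1..n. u j i * u k i * u l i) = (\<Sum>i=1..n. v j i * v k i * v l i)"
        if "n = 4" "1 \<le> j" "j < k" "k < l" "l \<le> m" for j k l
        using eq[of "[1, 1, 1]" "[j, k, l]"] that by (simp add: admissible_3 exps_def mult.assoc)
    qed
    then obtain \<sigma> where "\<sigma> permutes {1..n}" "\<And>j i. j \<in> {1..m} \<Longrightarrow> i \<in> {1..n} \<Longrightarrow> v j i = u j (\<sigma> i)"
      by blast
    then have "eval_at u f = eval_at v f" if "f \<in> invariants n m" for f
      using that eval_at_eq_if_same_orbit by blast
    then show False using sep by (auto simp: separated_by_def)
  qed
qed


section \<open>Pairs of vector tuples separated by a single power sum\<close>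

text \<open>
  The value of \<^term>\<open>psum n js k\<close> on the integer matrix \<open>U\<close>, given as a list of rows. Columns are
  counted from 0, rows from 1 as in \<^const>\<open>admissible\<close>.
\<close>

definition int_psum :: "nat \<Rightarrow> int list list \<Rightarrow> nat list \<Rightarrow> nat list \<Rightarrow> int"
  where "int_psum n U js k = (\<Sum>i<n. \<Prod>l<length k. U ! (js ! l - 1) ! i ^ (k ! l))"

text \<open>
  Among all power sums with exponents in \<open>K\<close> on \<open>length k\<close> rows, only the one with exponents \<open>k\<close> on
  all rows tells \<open>U\<close> from \<open>V\<close>. The divisibility forces the difference to be nonzero, also modulo
  every prime above \<open>n\<close>.
\<close>

definition isolates :: "nat \<Rightarrow> nat list set \<Rightarrow> nat list \<Rightarrow> int list list \<Rightarrow> int list list \<Rightarrow> bool"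
  where "isolates n K k U V \<longleftrightarrow>
    (\<forall>k'\<in>K. \<forall>js. admissible (length k') (length k) js \<longrightarrow> (js, k') \<noteq> ([1..<Suc (length k)], k) \<longrightarrow>
      int_psum n U js k' = int_psum n V js k') \<and>
    int_psum n U [1..<Suc (length k)] k - int_psum n V [1..<Suc (length k)] k dvd fact n ^ 3"


lemmas isolates_evaluation = isolates_def exps_def admissible_small int_psum_def fact_numeral
  all_conj_distrib lessThan_nat_numeral numeral_2_eq_2 numeral_3_eq_3 power4_eq_xxxx

text \<open>
  Most of the matrices \<open>V\<close> arise from \<open>U\<close> by a change of sign in one row or in all rows. The entries
  are chosen such that, among the power sums that are odd in the rows concerned, only the one to be
  isolated is nonzero; for example, \<open>3\<^sup>3 + 4\<^sup>3 + 5\<^sup>3 = 6\<^sup>3\<close> makes the cubes cancel. For \<open>tr(2,1)\<close> with \<open>n = 3\<close> a row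
  is rearranged instead. The other single-row examples are small integer solutions of systems of
  Prouhet-Tarry-Escott type, selected such that the difference has no prime factor above \<open>n\<close>.
\<close>

lemma isolates_2:
  "isolates 2 (exps 2) [1] [[1, 0]] [[- 1, 0]]"
  "isolates 2 (exps 2) [2] [[1, - 1]] [[0, 0]]"
  "isolates 2 (exps 2) [1, 1] [[1, - 1], [1, - 1]] [[1, - 1], [- 1, 1]]"
  by (simp_all add: isolates_evaluation)

lemma isolates_3:
  "isolates 3 (exps 3) [1] [[3, 5, 8]] [[- 4, - 1, 9]]"
  "isolates 3 (exps 3) [2] [[1, - 1, 0]] [[0, 0, 0]]"
  "isolates 3 (exps 3) [3] [[1, 1, - 2]] [[- 1, - 1, 2]]"
  "isolates 3 (exps 3) [1, 1] [[1, - 1, 0], [1, - 1, 0]] [[1, - 1, 0], [- 1, 1, 0]]"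
  "isolates 3 (exps 3) [2, 1] [[1, 0, - 1], [1, - 1, 0]] [[1, 0, - 1], [0, 1, - 1]]"
  by (simp_all add: isolates_evaluation)

lemma isolates_4:
  "isolates 4 (exps 4) [1] [[- 6, 3, 4, 5]] [[6, - 3, - 4, - 5]]"
  "isolates 4 (exps 4) [2] [[- 1, 0, 8, 21]] [[- 10, 3, 17, 18]]"
  "isolates 4 (exps 4) [3] [[1, 1, - 2, 0]] [[- 1, - 1, 2, 0]]"
  "isolates 4 (exps 4) [4] [[0, 0, 5, 5]] [[- 1, 2, 3, 6]]"
  "isolates 4 (exps 4) [1, 1] [[1, - 1, 2, - 2], [8, - 8, - 1, 1]] [[1, - 1, 2, - 2], [- 8, 8, 1, - 1]]"
  "isolates 4 (exps 4) [2, 1] [[1, 2, - 1, - 2], [1, - 1, 1, - 1]] [[1, 2, - 1, - 2], [- 1, 1, - 1, 1]]"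
  "isolates 4 (exps 4) [1, 2] [[1, - 1, 1, - 1], [1, 2, - 1, - 2]] [[- 1, 1, - 1, 1], [1, 2, - 1, - 2]]"
  "isolates 4 (exps 4) [3, 1] [[1, - 1, 2, - 2], [2, - 2, - 1, 1]] [[1, - 1, 2, - 2], [- 2, 2, 1, - 1]]"
  "isolates 4 (exps 4) [1, 1, 1] [[1, 1, - 1, - 1], [1, - 1, 1, - 1], [1, - 1, - 1, 1]]
    [[- 1, - 1, 1, 1], [- 1, 1, - 1, 1], [- 1, 1, 1, - 1]]"
  by (simp_all add: isolates_evaluation)

lemma ex_isolates:
  assumes "n \<in> {2, 3, 4}" "k \<in> exps n"
  shows "\<exists>U V. isolates n (exps n) k U V"
  using assms(1)
proof (elim insertE emptyE)
  assume "n = 2"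
  then show ?thesis using assms(2) isolates_2 by (auto simp: exps_def)
next
  assume "n = 3"
  then show ?thesis using assms(2) isolates_3 by (auto simp: exps_def)
next
  assume "n = 4"
  then show ?thesis using assms(2) isolates_4 by (auto simp: exps_def)
qed

text \<open>
  Row \<open>l\<close> of the integer matrix becomes row \<open>js ! l\<close> of the tuple, and all other rows are 0.
\<close>

definition embed_rows :: "nat \<Rightarrow> nat \<Rightarrow> nat list \<Rightarrow> int list list \<Rightarrow> nat \<Rightarrow> nat \<Rightarrow> 'a::comm_ring_1"
  where "embed_rows n m js U = (\<lambda>j\<in>{1..m}. \<lambda>i\<in>{1..n}.
    if j \<in> set js then of_int (U ! (THE l. l < length js \<and> js ! l = j) ! (i - 1)) else 0)"

lemma embed_rows_in_vec_tuples: "embed_rows n m js U \<in> vec_tuples n m"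
  by (auto simp: embed_rows_def vec_tuples_def)

lemma eval_at_embed_rows_within:
  assumes js: "admissible q m js" and js0: "admissible (length k) q js0"
  shows "eval_at (embed_rows n m js U) (psum n (map (\<lambda>l. js ! (l - 1)) js0) k :: 'a::comm_ring_1 vpoly) =
    of_int (int_psum n U js0 k)"
proof -
  have row: "embed_rows n m js U (js ! l) (Suc i) = (of_int (U ! l ! i) :: 'a)"
    if "l < q" "i < n" for l i
  proof -
    have "(THE l'. l' < length js \<and> js ! l' = js ! l) = l"
      using js admissible_distinct[OF js] that
      by (intro the_equality) (auto simp: admissible_def nth_eq_iff_index_eq)
    moreover have "js ! l \<in> set js" "js ! l \<in> {1..m}"
      using js that nth_mem[of l js] unfolding admissible_def by blast+
    ultimately show ?thesis using that by (simp add: embed_rows_def)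
  qed
  have pos: "js0 ! l - 1 < q" "l < length js0" if "l < length k" for l
  proof -
    show "l < length js0" using js0 that by (simp add: admissible_def)
    then have "js0 ! l \<in> {1..q}" using js0 nth_mem[of l js0] unfolding admissible_def by blast
    then show "js0 ! l - 1 < q" by auto
  qed
  show ?thesis
    unfolding eval_at_psum int_psum_def of_int_sum of_int_prod of_int_power One_nat_def sum.atLeast1_atMost_eq
    using pos row by (intro sum.cong prod.cong refl) simp
qed

text \<open>
  Such a power sum involves a zero row with a positive exponent.
\<close>

lemma eval_at_embed_rows_outside:
  assumes js': "admissible (length k) m js'" "\<not> set js' \<subseteq> set js" and k: "0 \<notin> set k"
  shows "eval_at (embed_rows n m js U) (psum n js' k :: 'a::comm_ring_1 vpoly) = 0"
proof -
  obtain x where "x \<in> set js'" "x \<notin> set js" using js'(2) by blast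
  moreover have length: "length js' = length k" and range: "set js' \<subseteq> {1..m}"
    using js'(1) by (simp_all add: admissible_def)
  ultimately obtain l where l: "l < length k" "js' ! l \<notin> set js"
    by (metis in_set_conv_nth)
  have "js' ! l \<in> {1..m}"
    using range length l(1) nth_mem[of l js'] by (intro subsetD[OF range]) simp
  moreover have "k ! l \<noteq> 0" using k l by (metis nth_mem)
  ultimately have "embed_rows n m js U (js' ! l) i ^ (k ! l) = (0 :: 'a)" if "i \<in> {1..n}" for i
    using l that by (simp add: embed_rows_def zero_power)
  then have "(\<Prod>l<length k. embed_rows n m js U (js' ! l) i ^ (k ! l)) = (0 :: 'a)" if "i \<in> {1..n}" for i
    using l that prod_zero[of "{..<length k}" "\<lambda>l. embed_rows n m js U (js' ! l) i ^ (k ! l) :: 'a"] by blast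
  then show ?thesis unfolding eval_at_psum by (intro sum.neutral) blast
qed

text \<open>
  A power sum that involves a row outside \<open>js\<close> vanishes on both tuples; on the rows in \<open>js\<close> the
  integer matrices decide.
\<close>

lemma separated_only_by:
  fixes n m :: nat
  assumes char: "\<And>r. 0 < r \<Longrightarrow> r \<le> n \<Longrightarrow> of_nat r \<noteq> (0::'a::field)"
    and iso: "isolates n K k U V" and "k \<in> K" and pos: "\<And>k. k \<in> K \<Longrightarrow> 0 \<notin> set k"
    and js: "admissible (length k) m js" and f: "f \<in> power_sums n K m"
  shows "eval_at (embed_rows n m js U) f \<noteq> eval_at (embed_rows n m js V) f \<longleftrightarrow>
    f = (psum n js k :: 'a vpoly)"
proof -
  let ?u = "embed_rows n m js U :: nat \<Rightarrow> nat \<Rightarrow> 'a"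
  let ?v = "embed_rows n m js V :: nat \<Rightarrow> nat \<Rightarrow> 'a"
  have js_id: "map (\<lambda>l. js ! (l - 1)) [1..<Suc (length k)] = js"
    using js by (intro nth_equalityI) (auto simp: admissible_def simp del: upt_Suc)
  show ?thesis
  proof
    assume differ: "eval_at ?u f \<noteq> eval_at ?v f"
    obtain js' k' where f': "f = psum n js' k'" "k' \<in> K" "admissible (length k') m js'"
      using f unfolding power_sums_def by blast
    have "set js' \<subseteq> set js"
      using eval_at_embed_rows_outside[OF f'(3) _ pos[OF f'(2)], of js n] differ f'(1) by metis
    then obtain js0 where js0: "admissible (length k') (length k) js0"
      "js' = map (\<lambda>l. js ! (l - 1)) js0"
      using admissible_within[OF js f'(3)] by blast
    then have "int_psum n U js0 k' \<noteq> int_psum n V js0 k'"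
      using differ eval_at_embed_rows_within[OF js js0(1), where 'a = 'a] f'(1) by metis
    then have "js0 = [1..<Suc (length k)]" "k' = k"
      using iso f'(2) js0(1) unfolding isolates_def by blast+
    then show "f = psum n js k" using f'(1) js0(2) js_id by simp
  next
    assume f_eq: "f = psum n js k"
    have adm: "admissible (length k) (length k) [1..<Suc (length k)]"
      by (auto simp: admissible_def simp del: upt_Suc)
    define D where "D = int_psum n U [1..<Suc (length k)] k - int_psum n V [1..<Suc (length k)] k"
    have "of_int (fact r) \<noteq> (0::'a)" if "r \<le> n" for r
      using that
    proof (induction r)
      case (Suc r)
      then show ?case using char[of "Suc r"] by (simp add: fact_Suc del: of_nat_Suc)
    qed simp
    then have "of_int (fact n ^ 3) \<noteq> (0::'a)" by (simp del: of_int_fact)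
    moreover obtain q where "fact n ^ 3 = D * q"
      using iso unfolding isolates_def D_def by (elim conjE dvdE)
    ultimately have "(of_int D :: 'a) \<noteq> 0" by auto
    moreover have "eval_at ?u f - eval_at ?v f = of_int D"
      using eval_at_embed_rows_within[OF js adm, where 'a = 'a] unfolding f_eq js_id D_def by simp
    ultimately show "eval_at ?u f \<noteq> eval_at ?v f" by auto
  qed
qed


section \<open>Minimality\<close>

theorem theorem2:
  fixes n m :: nat
  assumes "n \<in> {2, 3, 4}"
    and "CHAR('a::field) = 0 \<or> CHAR('a) > n"
    and "m \<ge> 2"
  shows "minimal_separating n m (T_set n m :: 'a vpoly set)"
proof -
  let ?T = "power_sums n (exps n) m :: 'a vpoly set"
  have char: "of_nat r \<noteq> (0::'a)" if "0 < r" "r \<le> n" for r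
    using assms(2) that by (auto simp: of_nat_eq_0_iff_char_dvd dest: dvd_imp_le)
  have "?T \<subseteq> S'" if S': "S' \<subseteq> ?T" "separating n m S'" for S'
  proof
    fix f assume "f \<in> ?T"
    then obtain js k where f: "f = psum n js k" "k \<in> exps n" "admissible (length k) m js"
      unfolding power_sums_def by blast
    obtain U V where iso: "isolates n (exps n) k U V"
      using ex_isolates[OF assms(1) f(2)] by blast
    have only_f: "eval_at (embed_rows n m js U) g \<noteq> eval_at (embed_rows n m js V) g \<longleftrightarrow> g = f"
      if "g \<in> ?T" for g
      unfolding f(1) using char
      by (rule separated_only_by[OF _ iso f(2) _ f(3) that]) (auto simp: exps_def split: if_splits)
    have "separated_by (invariants n m) (embed_rows n m js U) (embed_rows n m js V :: nat \<Rightarrow> nat \<Rightarrow> 'a)"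
      using only_f[OF \<open>f \<in> ?T\<close>] \<open>f \<in> ?T\<close> power_sums_subset_invariants
      unfolding separated_by_def by blast
    then obtain g where "g \<in> S'" "eval_at (embed_rows n m js U) g \<noteq> eval_at (embed_rows n m js V) g"
      using S'(2) embed_rows_in_vec_tuples unfolding separating_def separated_by_def by blast
    then show "f \<in> S'" using only_f[of g] S'(1) by blast
  qed
  then have "minimal_separating n m ?T"
    using separating_power_sums[OF assms(1) char] unfolding minimal_separating_def by blast
  then show ?thesis using T_set_eq_power_sums[OF assms(1,3), where 'a = 'a] by simp
qed

end
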